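(* Consider a Bayesian hypothesis test of a simple null hypothesis $H_0:\theta=\theta_0$ and let $\gamma>0$ be a fixed evidence threshold. Suppose there are a fixed $c\in\overline{\mathbb{R}}=\mathbb{R}\cup\{-\infty,+\infty\}$ (not depending on $\theta$) and a function $d$ on $\Theta$ such that either $\Omega_\gamma(\theta)=(c,d(\theta))$ for all $\theta\in\Theta$, or $\Omega_\gamma(\theta)=(d(\theta),c)$ for all $\theta\in\Theta$. Put $v=-1$ in the case $\Omega_\gamma(\theta)=(c,d(\theta))$ and $v=1$ in the case $\Omega_\gamma(\theta)=(d(\theta),c)$. If $$\theta^*=\arg\min_{\theta\in\Theta} v\,d(\theta),$$ then $H_1:\theta=\theta^*$ provides an alternative hypothesis corresponding to a UMPBT($\gamma$).
   Context: Let $\Theta\subseteq\mathbb{R}$ be the parameter space over which alternatives and data-generating parameters range, and let $\theta_0\in\mathbb{R}$ be the null value. Let $y\in\mathbb{R}$ be a scalar sufficient statistic of the data, having for each $\theta\in\Theta\cup\{\theta_0\}$ a density $f(y;\theta)$ with respect to a $\sigma$-finite measure $\mu$; the set $S(f)=\{y: f(y;\theta)>0\}$ is assumed not to depend on $\theta$. Measurability in $(y,\theta)$ is assumed so that the integrals below make sense. $\mathbf{P}_{\theta_t}$ denotes probability when $y$ has density $f(\cdot;\theta_t)$. The likelihood ratio in favor of $\theta$ is $g(y,\theta)=f(y;\theta)/f(y;\theta_0)$ for $y\in S(f)$, and for $\gamma>0$, $$\Omega_\gamma(\theta)=\{y: g(y,\theta)>\gamma\}.$$ An alternative hypothesis $H_i:\theta\sim\pi_i$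 is given by a prior probability distribution $\pi_i$ on $\Theta$ (point masses, i.e. simple alternatives, are allowed). The Bayes factor in favor of $H_i$ against $H_0:\theta=\theta_0$ is $\mathrm{BF}_{i0}(y)=\int_\Theta g(y,\theta)\,\pi_i(d\theta)$; for a simple alternative $H_1:\theta=\theta_1$ it equals $g(y,\theta_1)$. A uniformly most powerful Bayesian test for evidence threshold $\gamma>0$ in favor of $H_1$ against the fixed null $H_0$, denoted UMPBT($\gamma$), is a Bayesian hypothesis test whose Bayes factor satisfies, for every $\theta_t\in\Theta$ and every alternative hypothesis $H_2:\theta\sim\pi_2$, $$\mathbf{P}_{\theta_t}[\mathrm{BF}_{10}(y)>\gamma]\ge \mathbf{P}_{\theta_t}[\mathrm{BF}_{20}(y)>\gamma].$$ *)

theory Defs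
  imports "HOL-Probability.Probability"
begin

text \<open>
  The density \<open>f(y;\<theta>)\<close> is written \<open>f y \<theta>\<close>.  A distribution on the parameter space
  \<open>\<Theta>\<close> is a probability measure on the trace of the Borel sets on \<open>\<Theta>\<close>, so \<open>\<Theta>\<close> itself
  need not be Borel.
\<close>

definition sampling_measure :: "real measure \<Rightarrow> (real \<Rightarrow> real \<Rightarrow> real) \<Rightarrow> real \<Rightarrow> real measure" where
  "sampling_measure \<mu> f \<theta> = density \<mu> (\<lambda>y. ennreal (f y \<theta>))"

definition supp :: "(real \<Rightarrow> real \<Rightarrow> real) \<Rightarrow> real \<Rightarrow> real set" where
  "supp f \<theta> = {y. f y \<theta> > 0}"

locale dominated_model = sigma_finite_measure \<mu>
  for \<mu> :: "real measure" +
  fixes f :: "real \<Rightarrow> real \<Rightarrow> real" and \<Theta> :: "real set" and \<theta>0 :: real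
  assumes sets_mu: "sets \<mu> = sets borel"
    and measurable_f:
      "(\<lambda>(y, \<theta>). f y \<theta>) \<in> borel_measurable (\<mu> \<Otimes>\<^sub>M restrict_space borel (insert \<theta>0 \<Theta>))"
    and nonneg_f: "\<And>\<theta> y. \<theta> \<in> insert \<theta>0 \<Theta> \<Longrightarrow> 0 \<le> f y \<theta>"
    and prob_space_f: "\<And>\<theta>. \<theta> \<in> insert \<theta>0 \<Theta> \<Longrightarrow> prob_space (sampling_measure \<mu> f \<theta>)"
    and supp_f: "\<And>\<theta>. \<theta> \<in> insert \<theta>0 \<Theta> \<Longrightarrow> supp f \<theta> = supp f \<theta>0"

definition likelihood_ratio :: "(real \<Rightarrow> real \<Rightarrow> real) \<Rightarrow> real \<Rightarrow> real \<Rightarrow> real \<Rightarrow> real" where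
  "likelihood_ratio f \<theta>0 y \<theta> = f y \<theta> / f y \<theta>0"

text \<open>
  The likelihood ratio is only meaningful on the common support, which is \<open>supp f \<theta>0\<close>;
  \<open>LR_region\<close> is the set \<open>\<Omega>\<^sub>\<gamma>(\<theta>)\<close>.
\<close>

definition LR_region :: "(real \<Rightarrow> real \<Rightarrow> real) \<Rightarrow> real \<Rightarrow> real \<Rightarrow> real \<Rightarrow> real set" where
  "LR_region f \<theta>0 \<gamma> \<theta> = {y \<in> supp f \<theta>0. likelihood_ratio f \<theta>0 y \<theta> > \<gamma>}"

definition prior_on :: "real set \<Rightarrow> real measure \<Rightarrow> bool" where
  "prior_on \<Theta> \<pi> \<longleftrightarrow> prob_space \<pi> \<and> sets \<pi> = sets (restrict_space borel \<Theta>)"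

definition simple_alternative :: "real set \<Rightarrow> real \<Rightarrow> real measure" where
  "simple_alternative \<Theta> \<theta>1 = return (restrict_space borel \<Theta>) \<theta>1"

text \<open>
  The integral can be infinite at individual points \<open>y\<close>; there the Bayes factor is \<open>\<infinity>\<close> and
  exceeds every threshold, hence the nonnegative rather than the Bochner integral.
\<close>

definition bayes_factor ::
    "(real \<Rightarrow> real \<Rightarrow> real) \<Rightarrow> real \<Rightarrow> real measure \<Rightarrow> real \<Rightarrow> ennreal" where
  "bayes_factor f \<theta>0 \<pi> y = (\<integral>\<^sup>+ \<theta>. ennreal (likelihood_ratio f \<theta>0 y \<theta>) \<partial>\<pi>)"

definition rejection_prob ::
    "real measure \<Rightarrow> (real \<Rightarrow> real \<Rightarrow> real) \<Rightarrow> real \<Rightarrow> real \<Rightarrow> real measure \<Rightarrow> real \<Rightarrow> real" where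
  "rejection_prob \<mu> f \<theta>0 \<gamma> \<pi> \<theta>t =
     measure (sampling_measure \<mu> f \<theta>t) {y \<in> supp f \<theta>0. bayes_factor f \<theta>0 \<pi> y > ennreal \<gamma>}"

definition UMPBT ::
    "real measure \<Rightarrow> (real \<Rightarrow> real \<Rightarrow> real) \<Rightarrow> real set \<Rightarrow> real \<Rightarrow> real \<Rightarrow> real measure \<Rightarrow> bool" where
  "UMPBT \<mu> f \<Theta> \<theta>0 \<gamma> \<pi>1 \<longleftrightarrow>
     prior_on \<Theta> \<pi>1 \<and>
     (\<forall>\<theta>t\<in>\<Theta>. \<forall>\<pi>2. prior_on \<Theta> \<pi>2 \<longrightarrow>
        rejection_prob \<mu> f \<theta>0 \<gamma> \<pi>1 \<theta>t \<ge> rejection_prob \<mu> f \<theta>0 \<gamma> \<pi>2 \<theta>t)"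

end

theory Submission imports Defs begin

text \<open>
  A Bayes factor is an average of likelihood ratios, and an average exceeds \<open>\<gamma>\<close> only if one of
  the averaged values does. So whatever the prior, its rejection region lies in the union of the
  regions \<open>\<Omega>\<^sub>\<gamma>(\<theta>)\<close> over \<open>\<theta> \<in> \<Theta>\<close> (\<open>rejection_region_subset_Union\<close>). The rejection region of
  a simple alternative at \<open>\<theta>1\<close> is \<open>\<Omega>\<^sub>\<gamma>(\<theta>1)\<close> itself (\<open>rejection_region_simple_alternative\<close>).
  Hence a simple alternative whose region contains all the others is a UMPBT
  (\<open>UMPBT_of_largest_LR_region\<close>): it rejects on a larger set than any competitor, and this is so
  before any sampling distribution \<open>\<theta>\<^sub>t\<close> enters, which is why the optimality is uniform.

  When the regions are intervals sharing the endpoint \<open>c\<close>, they are linearly ordered by inclusion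
  through the other endpoint, and minimising \<open>v d(\<theta>)\<close> picks the largest of them.
\<close>

text \<open>
  The prior has total mass 1, so an integrand bounded by \<open>\<gamma>\<close> integrates to at most \<open>\<gamma>\<close>.
\<close>

lemma bayes_factor_gt_imp_ex_likelihood_ratio_gt:
  assumes prior: "prior_on \<Theta> \<pi>"
    and gt: "bayes_factor f \<theta>0 \<pi> y > ennreal \<gamma>"
  shows "\<exists>\<theta>\<in>\<Theta>. likelihood_ratio f \<theta>0 y \<theta> > \<gamma>"
proof (rule ccontr)
  assume none: "\<not> ?thesis"
  interpret prob_space \<pi>
    using prior by (simp add: prior_on_def)
  have "space \<pi> = \<Theta>"
    using prior sets_eq_imp_space_eq[of \<pi> "restrict_space borel \<Theta>"]
    by (simp add: prior_on_def space_restrict_space)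
  then have "bayes_factor f \<theta>0 \<pi> y \<le> (\<integral>\<^sup>+ \<theta>. ennreal \<gamma> \<partial>\<pi>)"
    unfolding bayes_factor_def
    using none by (intro nn_integral_mono) (auto simp: not_less intro: ennreal_leI)
  also have "\<dots> = ennreal \<gamma>"
    by (simp add: emeasure_space_1)
  finally show False
    using gt by simp
qed

lemma rejection_region_subset_Union:
  assumes "prior_on \<Theta> \<pi>"
  shows "{y \<in> supp f \<theta>0. bayes_factor f \<theta>0 \<pi> y > ennreal \<gamma>} \<subseteq> (\<Union>\<theta>\<in>\<Theta>. LR_region f \<theta>0 \<gamma> \<theta>)"
  using bayes_factor_gt_imp_ex_likelihood_ratio_gt[OF assms]
  by (fastforce simp: LR_region_def)

lemma prior_on_simple_alternative:
  assumes "\<theta>1 \<in> \<Theta>"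
  shows "prior_on \<Theta> (simple_alternative \<Theta> \<theta>1)"
  using assms
  by (auto simp: prior_on_def simple_alternative_def space_restrict_space intro!: prob_space_return)

context dominated_model
begin

lemma measurable_likelihood_ratio:
  "likelihood_ratio f \<theta>0 y \<in> borel_measurable (restrict_space borel \<Theta>)"
proof -
  have "y \<in> space \<mu>"
    using sets_eq_imp_space_eq[OF sets_mu] by simp
  then have "f y \<in> borel_measurable (restrict_space borel (insert \<theta>0 \<Theta>))"
    using measurable_compose[OF measurable_Pair1' measurable_f] by simp
  then have "f y \<in> borel_measurable (restrict_space borel \<Theta>)"
    by (rule measurable_restrict_mono) blast
  then show ?thesis
    unfolding likelihood_ratio_def by (rule borel_measurable_divide) (rule measurable_const, simp)
qed

lemma bayes_factor_simple_alternative: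
  assumes "\<theta>1 \<in> \<Theta>"
  shows "bayes_factor f \<theta>0 (simple_alternative \<Theta> \<theta>1) y = ennreal (likelihood_ratio f \<theta>0 y \<theta>1)"
  unfolding bayes_factor_def simple_alternative_def
  using assms measurable_likelihood_ratio
  by (subst nn_integral_return) (auto simp: space_restrict_space)

lemma rejection_region_simple_alternative:
  assumes "\<theta>1 \<in> \<Theta>" and "\<gamma> \<ge> 0"
  shows "{y \<in> supp f \<theta>0. bayes_factor f \<theta>0 (simple_alternative \<Theta> \<theta>1) y > ennreal \<gamma>}
    = LR_region f \<theta>0 \<gamma> \<theta>1"
  using assms
  by (simp add: LR_region_def bayes_factor_simple_alternative ennreal_less_iff)

text \<open>
  The inclusion of rejection regions does not mention the data-generating parameter, so monotonicity
  of measure gives the inequality of rejection probabilities under every \<open>\<theta>t\<close> at once.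
\<close>

theorem UMPBT_of_largest_LR_region:
  assumes \<theta>1: "\<theta>1 \<in> \<Theta>" and "\<gamma> \<ge> 0"
    and meas: "LR_region f \<theta>0 \<gamma> \<theta>1 \<in> sets borel"
    and largest: "\<And>\<theta>. \<theta> \<in> \<Theta> \<Longrightarrow> LR_region f \<theta>0 \<gamma> \<theta> \<subseteq> LR_region f \<theta>0 \<gamma> \<theta>1"
  shows "UMPBT \<mu> f \<Theta> \<theta>0 \<gamma> (simple_alternative \<Theta> \<theta>1)"
  unfolding UMPBT_def
proof (intro conjI ballI allI impI)
  show "prior_on \<Theta> (simple_alternative \<Theta> \<theta>1)"
    using \<theta>1 by (rule prior_on_simple_alternative)
next
  fix \<theta>t \<pi>2
  assume "\<theta>t \<in> \<Theta>" and prior: "prior_on \<Theta> \<pi>2"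
  then interpret P: prob_space "sampling_measure \<mu> f \<theta>t"
    using prob_space_f by simp
  have "{y \<in> supp f \<theta>0. bayes_factor f \<theta>0 \<pi>2 y > ennreal \<gamma>} \<subseteq> LR_region f \<theta>0 \<gamma> \<theta>1"
    using rejection_region_subset_Union[OF prior] largest by blast
  moreover have "LR_region f \<theta>0 \<gamma> \<theta>1 \<in> sets (sampling_measure \<mu> f \<theta>t)"
    using meas by (simp add: sampling_measure_def sets_mu)
  ultimately show "rejection_prob \<mu> f \<theta>0 \<gamma> \<pi>2 \<theta>t
      \<le> rejection_prob \<mu> f \<theta>0 \<gamma> (simple_alternative \<Theta> \<theta>1) \<theta>t"
    unfolding rejection_prob_def rejection_region_simple_alternative[OF \<theta>1 \<open>\<gamma> \<ge> 0\<close>]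
    by (rule P.finite_measure_mono)
qed

end

theorem corollary1:
  fixes \<mu> :: "real measure" and f :: "real \<Rightarrow> real \<Rightarrow> real" and \<Theta> :: "real set"
    and \<theta>0 \<gamma> \<theta>star :: real and c v :: ereal and d :: "real \<Rightarrow> ereal"
  assumes "dominated_model \<mu> f \<Theta> \<theta>0"
    and "\<gamma> > 0"
    and "(v = -1 \<and> (\<forall>\<theta>\<in>\<Theta>. LR_region f \<theta>0 \<gamma> \<theta> = einterval c (d \<theta>))) \<or>
         (v = 1 \<and> (\<forall>\<theta>\<in>\<Theta>. LR_region f \<theta>0 \<gamma> \<theta> = einterval (d \<theta>) c))"
    and "is_arg_min (\<lambda>\<theta>. v * d \<theta>) (\<lambda>\<theta>. \<theta> \<in> \<Theta>) \<theta>star"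
  shows "UMPBT \<mu> f \<Theta> \<theta>0 \<gamma> (simple_alternative \<Theta> \<theta>star)"
proof -
  interpret dominated_model \<mu> f \<Theta> \<theta>0 by fact
  have star: "\<theta>star \<in> \<Theta>" and min: "\<And>\<theta>. \<theta> \<in> \<Theta> \<Longrightarrow> v * d \<theta>star \<le> v * d \<theta>"
    using assms(4) by (auto simp: is_arg_min_linorder)
  have "LR_region f \<theta>0 \<gamma> \<theta>star \<in> sets borel"
    using assms(3) star by auto
  \<comment> \<open>The sign \<open>v\<close> turns the minimum into the extreme value of \<open>d\<close> that widens the interval.\<close>
  moreover have "LR_region f \<theta>0 \<gamma> \<theta> \<subseteq> LR_region f \<theta>0 \<gamma> \<theta>star" if "\<theta> \<in> \<Theta>" for \<theta>
    using assms(3)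
  proof (elim disjE conjE)
    assume "v = -1" and region: "\<forall>\<theta>\<in>\<Theta>. LR_region f \<theta>0 \<gamma> \<theta> = einterval c (d \<theta>)"
    then have "d \<theta> \<le> d \<theta>star"
      using min[OF that] by simp
    then show ?thesis
      using region star that by (auto simp: einterval_def)
  next
    assume "v = 1" and region: "\<forall>\<theta>\<in>\<Theta>. LR_region f \<theta>0 \<gamma> \<theta> = einterval (d \<theta>) c"
    then have "d \<theta>star \<le> d \<theta>"
      using min[OF that] by simp
    then show ?thesis
      using region star that by (auto simp: einterval_def)
  qed
  ultimately show ?thesis
    using star \<open>\<gamma> > 0\<close> by (intro UMPBT_of_largest_LR_region) auto
qed

end
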